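(* Consider the storage arbitrage setting given in the context, with value function derivative $v_t$ (extended to $\mathbb{R}$ by $-\infty$ above $E$ and $+\infty$ below $0$), random price $\lambda_t$ with cumulative distribution function $F_t$, and random marginal value $q_{t-1}(e)=\frac{d}{de}Q_{t-1}(e)$. Then for $e\in[0,E]$ and every $x\in\mathbb{R}$, the cumulative distribution of $q_{t-1}(e)$ is $$\mathbf{Pr}[q_{t-1}(e)\le x]=\begin{cases} 0 & \text{if } x<v_t(e+P\eta)\\ F_t(x\eta) & \text{if } v_t(e+P\eta)\le x<v_t(e)\\ F_t([x/\eta+c]^+) & \text{if } v_t(e)\le x<v_t(e-P/\eta)\\ 1 & \text{if } x\ge v_t(e-P/\eta).\end{cases}$$
   Context: $[x]^+=\max\{x,0\}$. Parameters: power rating $P>0$, energy capacity $E>0$, efficiency $\eta\in(0,1]$, marginal discharge cost $c>0$. The prices $\lambda_1,\dots,\lambda_T$ are independent real random variables; $\lambda_t$ has probability density $f_t$ and cumulative distribution function $F_t$. For $1\le t\le T$, given a value function $V_t:[0,E]\to\mathbb{R}$, define for a starting state of charge $e\in[0,E]$ the random variable (a function of $\lambda_t$) $$Q_{t-1}(e)=\max_{p^{\mathrm c},\,p^{\mathrm d},\,e_t}\ \lambda_t(p^{\mathrm d}-p^{\mathrm c})-c\,p^{\mathrm d}+V_t(e_t)$$ subject to $0\le p^{\mathrm c}\le P$, $0\le p^{\mathrm d}\le P$, $p^{\mathrm d}>0$ only if $\lambda_t>0$ (this replaces the requirement that $p^{\mathrm c}$ or $p^{\mathrm d}$ be zero),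 $e_t-e=-p^{\mathrm d}/\eta+p^{\mathrm c}\eta$, and $0\le e_t\le E$. The value functions satisfy $V_{t-1}(e)=\mathbb{E}[Q_{t-1}(e)]$, with $V_T$ a given end-value function. Standing assumptions: $V_t$ is concave and differentiable on $[0,E]$, and $Q_{t-1}$ is treated as differentiable on $[0,E]$ (derivatives at the endpoints $0$ and $E$ being one-sided), so that $q_{t-1}(e)=\frac{d}{de}Q_{t-1}(e)$ is defined (almost surely) at the point $e$ considered. The function $v_t$ is the derivative of $V_t$ on $[0,E]$ (monotonically decreasing), extended by $v_t(e)=-\infty$ for $e>E$ and $v_t(e)=+\infty$ for $e<0$.
   Formalization: The formal theorem excludes two corner cases, $e=E=P/\eta$ and $e=0$ with $E=P\eta$, where the stated formula fails (e.g. $V_t=0$, $P=E=\eta=c=1$, $\lambda_t$ uniform on $[5,6]$, $e=1$: $q=\lambda_t-1\ge 4$ but the formula gives $\Pr[q\le 0]=1$). *)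

theory Defs
  imports "HOL-Probability.Probability"
begin

definition feasible :: "real \<Rightarrow> real \<Rightarrow> real \<Rightarrow> real \<Rightarrow> real \<Rightarrow> (real \<times> real \<times> real) set" where
  "feasible P E \<eta> price e =
     {(pc, pd, e'). 0 \<le> pc \<and> pc \<le> P \<and> 0 \<le> pd \<and> pd \<le> P \<and> (pd > 0 \<longrightarrow> price > 0) \<and>
        e' - e = - pd / \<eta> + pc * \<eta> \<and> 0 \<le> e' \<and> e' \<le> E}"

definition profit :: "real \<Rightarrow> (real \<Rightarrow> real) \<Rightarrow> real \<Rightarrow> real \<times> real \<times> real \<Rightarrow> real" where
  "profit c V price = (\<lambda>(pc, pd, e'). price * (pd - pc) - c * pd + V e')"

text \<open>The supremum below is a maximum whenever \<open>V\<close> is continuous on \<open>[0, E]\<close> and \<open>e\<close> lies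
  in \<open>[0, E]\<close>; see the lemma \<open>opt_value_attained\<close>.\<close>

definition opt_value ::
  "real \<Rightarrow> real \<Rightarrow> real \<Rightarrow> real \<Rightarrow> (real \<Rightarrow> real) \<Rightarrow> real \<Rightarrow> real \<Rightarrow> real" where
  "opt_value P E \<eta> c V price e = (SUP u\<in>feasible P E \<eta> price e. profit c V price u)"

text \<open>Derivatives are taken within \<open>[0, E]\<close>: two-sided in the interior, one-sided at \<open>0\<close>
  and \<open>E\<close>.\<close>

definition marginal_opt_value ::
  "real \<Rightarrow> real \<Rightarrow> real \<Rightarrow> real \<Rightarrow> (real \<Rightarrow> real) \<Rightarrow> real \<Rightarrow> real \<Rightarrow> real" where
  "marginal_opt_value P E \<eta> c V price e =
     vector_derivative (opt_value P E \<eta> c V price) (at e within {0..E})"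

definition marginal_value :: "real \<Rightarrow> (real \<Rightarrow> real) \<Rightarrow> real \<Rightarrow> ereal" where
  "marginal_value E V e =
     (if e > E then - \<infinity> else if e < 0 then \<infinity>
      else ereal (vector_derivative V (at e within {0..E})))"

lemma opt_value_attained:
  assumes "P > 0" "e \<in> {0..E}" and V: "continuous_on {0..E} V"
  obtains u where "u \<in> feasible P E \<eta> price e"
    and "opt_value P E \<eta> c V price e = profit c V price u"
    and "\<And>w. w \<in> feasible P E \<eta> price e \<Longrightarrow> profit c V price w \<le> profit c V price u"
proof -
  let ?F = "feasible P E \<eta> price e"
  let ?D = "if price > 0 then P else 0"
  let ?B = "{0..P} \<times> {0..?D} \<times> {0..E}"
  let ?C = "{u. snd (snd u) - e = - fst (snd u) / \<eta> + fst u * \<eta>}"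
  have F: "?F = ?B \<inter> ?C"
    using \<open>P > 0\<close> by (auto simp: feasible_def)
  have "closed ?C"
    unfolding divide_inverse by (intro closed_Collect_eq continuous_intros)
  then have "compact ?F"
    unfolding F by (intro compact_Int_closed compact_Times compact_Icc)
  moreover have "(0, 0, e) \<in> ?F"
    using assms by (simp add: feasible_def)
  then have "?F \<noteq> {}"
    by blast
  moreover have "continuous_on ?F (profit c V price)"
    unfolding profit_def case_prod_beta
    by (intro continuous_intros continuous_on_compose2[OF V]) (auto simp: feasible_def)
  ultimately obtain u where u: "u \<in> ?F" "\<forall>w\<in>?F. profit c V price w \<le> profit c V price u"
    using continuous_attains_sup by blast
  then have "opt_value P E \<eta> c V price e = profit c V price u"
    unfolding opt_value_def by (intro cSup_eq_maximum) auto
  with u that show thesis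
    by blast
qed

end

theory Submission
  imports Defs
begin

text \<open>Fix the price \<open>L\<close>. Concavity of \<open>V\<close> makes any \<open>d\<close> satisfying the optimality conditions
  together with some policy a supergradient of the optimal value \<open>W L\<close> at \<open>e\<close>. If moreover the
  policy can be perturbed, for starting states near \<open>e\<close>, so that its profit has slope \<open>d\<close> at \<open>e\<close>,
  then \<open>W L\<close> is squeezed between this profit and the supergradient, and its derivative is \<open>d\<close>.
  The five kinds of policy (charge fully, charge partially, hold, discharge partially, discharge
  fully) give \<open>d\<close> as \<open>v (e + P * \<eta>)\<close>, \<open>L / \<eta>\<close>, \<open>v e\<close>, \<open>(L - c) * \<eta>\<close> and \<open>v (e - P / \<eta>)\<close>.
  The perturbation fails only if a full charge ends exactly at \<open>E\<close>, or a full discharge exactly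
  at \<open>0\<close>; then there are two supergradients, so \<open>W L\<close> is not differentiable at \<open>e\<close>, which by
  assumption happens almost never.\<close>

section \<open>Supergradients and derivatives on an interval\<close>

definition supergradient :: "real set \<Rightarrow> (real \<Rightarrow> real) \<Rightarrow> real \<Rightarrow> real \<Rightarrow> bool" where
  "supergradient S g a d \<longleftrightarrow> (\<forall>w\<in>S. g w \<le> g a + d * (w - a))"

lemma supergradientD: "supergradient S g a d \<Longrightarrow> w \<in> S \<Longrightarrow> g w \<le> g a + d * (w - a)"
  by (simp add: supergradient_def)

text \<open>Otherwise \<open>g y - d * y\<close> would increase strictly just to the right of its
  maximiser \<open>a\<close>. Only points right of \<open>a\<close> enter, so \<open>a = l\<close>
  is allowed; the mirrored lemma below allows \<open>a = u\<close>. At an end point only one of the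
  two comparisons is available.\<close>

lemma deriv_le_supergradient:
  assumes g: "(g has_real_derivative D) (at a within {l..u})"
    and "supergradient {l..u} g a d" "l \<le> a" "a < u"
  shows "D \<le> d"
proof (rule ccontr)
  assume "\<not> D \<le> d"
  moreover have "((\<lambda>y. g y - d * y) has_real_derivative D - d) (at a within {l..u})"
    by (auto intro!: derivative_eq_intros g)
  ultimately obtain \<delta> where \<delta>: "\<delta> > 0"
    "\<And>h. h > 0 \<Longrightarrow> a + h \<in> {l..u} \<Longrightarrow> h < \<delta> \<Longrightarrow> g a - d * a < g (a + h) - d * (a + h)"
    using has_real_derivative_pos_inc_right[of "\<lambda>y. g y - d * y" "D - d" a "{l..u}"] by auto
  define h where "h = min (\<delta> / 2) (u - a)"
  have "h > 0" "a + h \<in> {l..u}" "h < \<delta>"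
    using assms(3,4) \<delta>(1) by (auto simp: h_def)
  with \<delta>(2)[of h] supergradientD[OF assms(2), of "a + h"] show False
    by (simp add: algebra_simps)
qed

lemma supergradient_le_deriv:
  assumes g: "(g has_real_derivative D) (at a within {l..u})"
    and "supergradient {l..u} g a d" "l < a" "a \<le> u"
  shows "d \<le> D"
proof (rule ccontr)
  assume "\<not> d \<le> D"
  moreover have "((\<lambda>y. g y - d * y) has_real_derivative D - d) (at a within {l..u})"
    by (auto intro!: derivative_eq_intros g)
  ultimately obtain \<delta> where \<delta>: "\<delta> > 0"
    "\<And>h. h > 0 \<Longrightarrow> a - h \<in> {l..u} \<Longrightarrow> h < \<delta> \<Longrightarrow> g a - d * a < g (a - h) - d * (a - h)"
    using has_real_derivative_neg_dec_left[of "\<lambda>y. g y - d * y" "D - d" a "{l..u}"] by auto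
  define h where "h = min (\<delta> / 2) (a - l)"
  have "h > 0" "a - h \<in> {l..u}" "h < \<delta>"
    using assms(3,4) \<delta>(1) by (auto simp: h_def)
  with \<delta>(2)[of h] supergradientD[OF assms(2), of "a - h"] show False
    by (simp add: algebra_simps)
qed

text \<open>Along the segment from \<open>a\<close> to \<open>w\<close>, the chord slope is compared
  with the derivative at the starting point by the one-sided lemma for the left end point.\<close>

lemma concave_on_supergradient:
  assumes g: "concave_on {l..u} g" "(g has_real_derivative D) (at a within {l..u})" "a \<in> {l..u}"
  shows "supergradient {l..u} g a D"
  unfolding supergradient_def
proof
  fix w assume w: "w \<in> {l..u}"
  \<comment> \<open>With the sign reversed, concavity places \<open>\<phi>\<close> below its chord
    over \<open>{0..1}\<close>, so the chord slope is a supergradient at the end point 0 even though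
    \<open>\<phi>\<close> is convex.\<close>
  define \<phi> where "\<phi> s = - g (a + s * (w - a))" for s
  have seg: "a + s * (w - a) \<in> {l..u}" if "s \<in> {0..1}" for s
    using convexD_alt[of "{l..u}" a w s] w g(3) that by (simp add: algebra_simps)
  have "(g \<circ> (\<lambda>s. a + s * (w - a)) has_real_derivative D * (w - a)) (at 0 within {0..1})"
  proof (rule DERIV_image_chain)
    show "((\<lambda>s. a + s * (w - a)) has_real_derivative w - a) (at 0 within {0..1})"
      by (auto intro!: derivative_eq_intros)
    show "(g has_real_derivative D) (at (a + 0 * (w - a)) within (\<lambda>s. a + s * (w - a)) ` {0..1})"
      using g(2) by (rule_tac DERIV_subset[of _ _ _ "{l..u}"]) (use seg in auto)
  qed
  then have "(\<phi> has_real_derivative - (D * (w - a))) (at 0 within {0..1})"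
    unfolding \<phi>_def o_def by (rule DERIV_minus)
  moreover have "supergradient {0..1} \<phi> 0 (g a - g w)"
    unfolding supergradient_def
  proof
    fix s :: real assume "s \<in> {0..1}"
    then show "\<phi> s \<le> \<phi> 0 + (g a - g w) * (s - 0)"
      using concave_onD[OF g(1), of s a w] w g(3) by (simp add: \<phi>_def algebra_simps)
  qed
  ultimately have "- (D * (w - a)) \<le> g a - g w"
    by (rule deriv_le_supergradient) auto
  then show "g w \<le> g a + D * (w - a)"
    by simp
qed

text \<open>After subtracting the line of slope \<open>d\<close> through the common point,
  \<open>g\<close> lies between \<open>lo\<close> and 0, so its remainder is no larger in absolute
  value than that of \<open>lo\<close>.\<close>

lemma has_real_derivative_squeeze:
  fixes lo g :: "real \<Rightarrow> real"
  assumes lo: "(lo has_real_derivative d) (at a within S)" "lo a = g a"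
    and le: "eventually (\<lambda>y. lo y \<le> g y) (at a within S)"
    and up: "supergradient S g a d"
  shows "(g has_real_derivative d) (at a within S)"
proof -
  have "((\<lambda>y. (lo y - lo a) / (y - a) - d) \<longlongrightarrow> 0) (at a within S)"
    using lo(1) unfolding has_field_derivative_iff by (simp add: LIM_zero)
  moreover have "eventually (\<lambda>y. norm ((g y - g a) / (y - a) - d)
      \<le> norm ((lo y - lo a) / (y - a) - d)) (at a within S)"
  proof -
    have "eventually (\<lambda>y. y \<in> S \<and> y \<noteq> a) (at a within S)"
      by (auto simp: eventually_at_filter)
    with le show ?thesis
    proof eventually_elim
      case (elim y)
      then have "\<bar>(g y - g a) - d * (y - a)\<bar> \<le> \<bar>(lo y - lo a) - d * (y - a)\<bar>"
        using supergradientD[OF up, of y] lo(2) by auto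
      then have "\<bar>(g y - g a) - d * (y - a)\<bar> / \<bar>y - a\<bar> \<le> \<bar>(lo y - lo a) - d * (y - a)\<bar> / \<bar>y - a\<bar>"
        by (rule divide_right_mono) simp
      then show ?case
        using elim by (simp add: abs_divide[symmetric] diff_divide_distrib)
    qed
  qed
  ultimately have "((\<lambda>y. (g y - g a) / (y - a) - d) \<longlongrightarrow> 0) (at a within S)"
    by (rule Lim_null_comparison[rotated, OF tendsto_norm_zero])
  then show ?thesis
    unfolding has_field_derivative_iff by (simp add: LIM_zero_iff)
qed

section \<open>The storage problem and its marginal value\<close>

locale storage =
  fixes P E \<eta> c :: real and V :: "real \<Rightarrow> real"
  assumes P: "P > 0" and E: "E > 0" and \<eta>: "0 < \<eta>" "\<eta> \<le> 1" and c: "c > 0"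
    and concave: "concave_on {0..E} V"
    and diff: "V differentiable_on {0..E}"
begin

abbreviation v :: "real \<Rightarrow> ereal" where
  "v \<equiv> marginal_value E V"

abbreviation W :: "real \<Rightarrow> real \<Rightarrow> real" where
  "W \<equiv> opt_value P E \<eta> c V"

abbreviation q :: "real \<Rightarrow> real \<Rightarrow> real" where
  "q \<equiv> marginal_opt_value P E \<eta> c V"

abbreviation D :: "real \<Rightarrow> real" where
  "D y \<equiv> vector_derivative V (at y within {0..E})"

lemma V_deriv: "y \<in> {0..E} \<Longrightarrow> (V has_real_derivative D y) (at y within {0..E})"
  using diff unfolding differentiable_on_def has_real_derivative_iff_has_vector_derivative
  by (simp add: vector_derivative_works)

lemma v_eq_D: "y \<in> {0..E} \<Longrightarrow> v y = ereal (D y)"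
  by (simp add: marginal_value_def)

lemma supergradient_V: "y \<in> {0..E} \<Longrightarrow> supergradient {0..E} V y (D y)"
  using concave V_deriv by (rule concave_on_supergradient)

lemma v_antimono:
  assumes "y \<le> z"
  shows "v z \<le> v y"
proof (cases "0 \<le> y \<and> y < z \<and> z \<le> E")
  case True
  then have "D z \<le> D y"
    \<comment> \<open>Adding the two inequalities cancels \<open>V y\<close> and \<open>V z\<close>
      and leaves \<open>0 \<le> (D y - D z) * (z - y)\<close>.\<close>
    using supergradientD[OF supergradient_V, of y z] supergradientD[OF supergradient_V, of z y]
    by (smt (verit, best) atLeastAtMost_iff mult_le_cancel_right mult_minus_right)
  with True show ?thesis
    by (simp add: marginal_value_def)
next
  case False
  with assms show ?thesis
    by (auto simp: marginal_value_def)
qed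

lemma v_le_supergradient: "supergradient {0..E} V y d \<Longrightarrow> 0 \<le> y \<Longrightarrow> y < E \<Longrightarrow> v y \<le> ereal d"
  using deriv_le_supergradient[OF V_deriv] by (simp add: v_eq_D)

lemma supergradient_le_v: "supergradient {0..E} V y d \<Longrightarrow> 0 < y \<Longrightarrow> y \<le> E \<Longrightarrow> ereal d \<le> v y"
  using supergradient_le_deriv[OF V_deriv] by (simp add: v_eq_D)

text \<open>If the maximiser of \<open>V w - d * w\<close> over \<open>[0, E]\<close> lies outside \<open>[a, b]\<close>, then the nearer of
  \<open>a\<close> and \<open>b\<close> is a maximiser as well. This replaces an intermediate value argument for \<open>v\<close>.\<close>

lemma supergradient_between:
  assumes "v b \<le> ereal d" "ereal d \<le> v a" "a \<le> b" "a \<le> E" "0 \<le> b"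
  obtains z where "z \<in> {0..E}" "a \<le> z" "z \<le> b" "supergradient {0..E} V z d"
proof -
  have V: "continuous_on {0..E} V"
    using diff by (rule differentiable_imp_continuous_on)
  have "continuous_on {0..E} (\<lambda>y. V y - d * y)"
    by (intro continuous_intros V)
  then obtain z where z: "z \<in> {0..E}" "\<And>y. y \<in> {0..E} \<Longrightarrow> V y - d * y \<le> V z - d * z"
    using continuous_attains_sup[of "{0..E}" "\<lambda>y. V y - d * y"] E by auto
  have sup: "supergradient {0..E} V y d" if "V z - d * z \<le> V y - d * y" for y
    unfolding supergradient_def using z(2) that by (smt (verit) right_diff_distrib)
  consider "z < a" | "b < z" | "a \<le> z" "z \<le> b"
    by linarith
  then show thesis
  proof cases
    case 1
    \<comment> \<open>\<open>a\<close> may be negative and \<open>b\<close> may exceed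
      \<open>E\<close>, where \<open>v\<close> is infinite. The maximiser \<open>z\<close> cannot
      lie beyond such a bound, so \<open>v\<close> is compared only where it is a real
      derivative.\<close>
    with z(1) assms(4) have a: "a \<in> {0..E}"
      by auto
    have "D a * (z - a) \<le> d * (z - a)"
      using 1 assms(2) a by (intro mult_right_mono_neg) (auto simp: v_eq_D)
    then have "V z - d * z \<le> V a - d * a"
      using supergradientD[OF supergradient_V[OF a] z(1)] by (simp add: algebra_simps)
    then show thesis
      using that[of a] a assms(3) sup by auto
  next
    case 2
    with z(1) assms(5) have b: "b \<in> {0..E}"
      by auto
    have "D b * (z - b) \<le> d * (z - b)"
      using 2 assms(1) b by (intro mult_right_mono) (auto simp: v_eq_D)
    then have "V z - d * z \<le> V b - d * b"
      using supergradientD[OF supergradient_V[OF b] z(1)] by (simp add: algebra_simps)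
    then show thesis
      using that[of b] b assms(3) sup by auto
  next
    case 3
    with z sup show thesis
      using that by blast
  qed
qed

section \<open>Optimal value and optimality conditions\<close>

text \<open>A real supremum bounds its family only if the family is bounded above; attainment of the
  maximum supplies this.\<close>

lemma profit_le_W:
  assumes "y \<in> {0..E}" "u \<in> feasible P E \<eta> L y"
  shows "profit c V L u \<le> W L y"
proof -
  have "continuous_on {0..E} V"
    using diff by (rule differentiable_imp_continuous_on)
  with P assms(1) show ?thesis
    using assms(2) by (rule_tac opt_value_attained[of P y E V \<eta> L c]) auto
qed

text \<open>The Karush--Kuhn--Tucker conditions: \<open>d\<close> is the multiplier of the state equation.\<close>

definition kkt :: "real \<Rightarrow> real \<Rightarrow> real \<times> real \<times> real \<Rightarrow> real \<Rightarrow> bool" where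
  "kkt L y = (\<lambda>(pc, pd, z) d. (pc, pd, z) \<in> feasible P E \<eta> L y \<and> supergradient {0..E} V z d \<and>
     (\<forall>p. 0 \<le> p \<and> p \<le> P \<longrightarrow> p * (d * \<eta> - L) \<le> pc * (d * \<eta> - L)) \<and>
     (\<forall>p. 0 \<le> p \<and> p \<le> P \<and> (p > 0 \<longrightarrow> L > 0) \<longrightarrow> p * (L - c - d / \<eta>) \<le> pd * (L - c - d / \<eta>)))"

text \<open>Once the supergradient inequality and the state equation are inserted, the bound on the
  profit separates into terms in the charge, the discharge and \<open>y\<close>. The conditions
  maximise the first two, and \<open>y\<close> contributes \<open>d * (y - e)\<close>.\<close>

lemma kkt_bound:
  assumes "kkt L e u d" "y \<in> {0..E}"
  shows "W L y \<le> profit c V L u + d * (y - e)"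
  unfolding opt_value_def
proof (rule cSUP_least)
  have "(0, 0, y) \<in> feasible P E \<eta> L y"
    using assms(2) P by (simp add: feasible_def)
  then show "feasible P E \<eta> L y \<noteq> {}"
    by blast
next
  fix r assume r: "r \<in> feasible P E \<eta> L y"
  obtain pc pd z where u: "u = (pc, pd, z)"
    by (cases u)
  obtain rc rd x where rr: "r = (rc, rd, x)"
    by (cases r)
  from assms(1) have z: "z = e - pd / \<eta> + pc * \<eta>"
    by (simp add: kkt_def u feasible_def)
  from r have x: "x = y - rd / \<eta> + rc * \<eta>" "x \<in> {0..E}"
    by (auto simp: rr feasible_def)
  have "V x \<le> V z + d * (x - z)"
    using assms(1) x(2) by (auto simp: kkt_def u intro: supergradientD)
  moreover have "rc * (d * \<eta> - L) \<le> pc * (d * \<eta> - L)"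
    "rd * (L - c - d / \<eta>) \<le> pd * (L - c - d / \<eta>)"
    using assms(1) r by (auto simp: kkt_def u rr feasible_def)
  ultimately show "profit c V L r \<le> profit c V L u + d * (y - e)"
    unfolding u rr profit_def x(1) z by (simp add: algebra_simps)
qed

lemma kkt_W_eq:
  assumes "kkt L e u d" "e \<in> {0..E}"
  shows "W L e = profit c V L u"
proof (rule antisym)
  show "W L e \<le> profit c V L u"
    using kkt_bound[OF assms] by simp
  show "profit c V L u \<le> W L e"
    using assms by (auto simp: kkt_def intro!: profit_le_W)
qed

lemma kkt_supergradient:
  assumes "kkt L e u d" "e \<in> {0..E}"
  shows "supergradient {0..E} (W L) e d"
  unfolding supergradient_def using kkt_bound[OF assms(1)] kkt_W_eq[OF assms] by simp

text \<open>\<open>s y\<close> is the profit of a policy adapted to the starting state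
  \<open>y\<close>. It supports \<open>W L\<close> from below at \<open>e\<close>, while the
  multiplier supports it from above.\<close>

lemma q_eqI:
  assumes "kkt L e u d" "e \<in> {0..E}"
    and s: "(s has_real_derivative d') (at e within {0..E})" "d' = d" "s e = profit c V L u"
      "eventually (\<lambda>y. y \<in> {0..E} \<longrightarrow> (\<exists>r\<in>feasible P E \<eta> L y. s y = profit c V L r)) (nhds e)"
  shows "q L e = d"
proof -
  have "eventually (\<lambda>y. s y \<le> W L y) (at e within {0..E})"
    using assms(2) unfolding eventually_at_filter using s(4) by eventually_elim (metis profit_le_W)
  then have "(W L has_real_derivative d) (at e within {0..E})"
    using s(3) kkt_W_eq[OF assms(1,2)] kkt_supergradient[OF assms(1,2)]
    by (intro has_real_derivative_squeeze[OF s(1)[unfolded s(2)]]) simp_all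
  \<comment> \<open>\<open>E > 0\<close> makes derivatives within \<open>[0, E]\<close> unique, also
    at the end points.\<close>
  with E assms(2) show ?thesis
    unfolding marginal_opt_value_def
    by (simp add: has_real_derivative_iff_has_vector_derivative vector_derivative_within_closed_interval)
qed

text \<open>Without a derivative, \<open>q\<close> is the choice operator applied to the empty predicate, hence the same
  constant at every such price. This matters for measurability, as \<open>M\<close> need not be complete.\<close>

lemma kkt_not_differentiable:
  assumes "kkt L e u d" "kkt L e u' d'" "d \<noteq> d'" "0 < e" "e < E"
  shows "\<not> W L differentiable (at e within {0..E})" "q L e = (SOME D. False)"
proof -
  have no: "\<not> (W L has_real_derivative D) (at e within {0..E})" for D
  proof
    assume "(W L has_real_derivative D) (at e within {0..E})"
    \<comment> \<open>At an interior point both one-sided comparisons apply, so a derivative equals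
      every supergradient.\<close>
    then have "D = k" if "supergradient {0..E} (W L) e k" for k
      using that assms(4,5) deriv_le_supergradient supergradient_le_deriv
      by (meson antisym less_imp_le)
    moreover have "supergradient {0..E} (W L) e d" "supergradient {0..E} (W L) e d'"
      using assms by (auto intro: kkt_supergradient)
    ultimately show False
      using assms(3) by blast
  qed
  then show "\<not> W L differentiable (at e within {0..E})"
    by (simp add: real_differentiable_def)
  show "q L e = (SOME D. False)"
    using no unfolding marginal_opt_value_def vector_derivative_def
    by (simp add: has_real_derivative_iff_has_vector_derivative)
qed

section \<open>Multipliers for charging, discharging and holding\<close>

text \<open>All of \<open>[0, E]\<close> lies to the left of \<open>E\<close>, where a smaller slope
  only raises the line. This gives the second multiplier at a kink; the next lemma is the
  counterpart at 0.\<close>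

lemma supergradient_V_E:
  assumes "d \<le> D E"
  shows "supergradient {0..E} V E d"
  unfolding supergradient_def
proof
  fix w assume w: "w \<in> {0..E}"
  then have "D E * (w - E) \<le> d * (w - E)"
    using assms by (intro mult_right_mono_neg) auto
  then show "V w \<le> V E + d * (w - E)"
    using supergradientD[OF supergradient_V[of E] w] E by simp
qed

lemma supergradient_V_0:
  assumes "D 0 \<le> d"
  shows "supergradient {0..E} V 0 d"
  unfolding supergradient_def
proof
  fix w assume w: "w \<in> {0..E}"
  then have "D 0 * (w - 0) \<le> d * (w - 0)"
    using assms by (intro mult_right_mono) auto
  then show "V w \<le> V 0 + d * (w - 0)"
    using supergradientD[OF supergradient_V[of 0] w] E by simp
qed

text \<open>The round-trip loss makes charging and discharging mutually exclusive at a positive price.\<close>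

lemma round_trip_loss:
  assumes "0 < L" "L \<le> d * \<eta>"
  shows "L - c < d / \<eta>"
proof -
  have "0 < d"
    using assms \<eta> by (smt (verit) mult_nonpos_nonneg)
  then have "d * \<eta> \<le> d" "d \<le> d / \<eta>"
    using \<eta> by (auto simp: mult_left_le field_simps)
  with assms c show ?thesis
    by linarith
qed

text \<open>The charge enters linearly with slope \<open>d * \<eta> - L\<close>: a positive slope
  forces full power, slope zero permits any charge. Discharging is unprofitable by the round-trip
  loss if \<open>L > 0\<close> and forbidden otherwise.\<close>

lemma kkt_charge:
  assumes "(pc, 0, z) \<in> feasible P E \<eta> L e" "supergradient {0..E} V z d"
    and L: "L \<le> d * \<eta>" "L < d * \<eta> \<Longrightarrow> pc = P"
  shows "kkt L e (pc, 0, z) d"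
proof -
  have "p * (d * \<eta> - L) \<le> pc * (d * \<eta> - L)" if "p \<le> P" for p
  proof (cases "L < d * \<eta>")
    case True
    with that L show ?thesis
      by (simp add: mult_right_mono)
  qed (use L in simp)
  moreover have "p * (L - c - d / \<eta>) \<le> 0" if "0 \<le> p" "p > 0 \<longrightarrow> L > 0" for p
    using that round_trip_loss[of L d] L
    by (cases "p = 0") (auto intro!: mult_nonneg_nonpos)
  ultimately show ?thesis
    using assms by (simp add: kkt_def)
qed

lemma kkt_discharge:
  assumes "(0, pd, z) \<in> feasible P E \<eta> L e" "supergradient {0..E} V z d" "0 < L"
    and L: "d / \<eta> \<le> L - c" "d / \<eta> < L - c \<Longrightarrow> pd = P"
  shows "kkt L e (0, pd, z) d"
proof -
  have "p * (L - c - d / \<eta>) \<le> pd * (L - c - d / \<eta>)" if "p \<le> P" for p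
  proof (cases "d / \<eta> < L - c")
    case True
    with that L show ?thesis
      by (simp add: mult_right_mono)
  qed (use L in simp)
  \<comment> \<open>Contrapositive of the round-trip loss: where discharging does not lose, charging
    does not gain.\<close>
  moreover have "d * \<eta> \<le> L"
    using round_trip_loss[of L d] assms(3) L(1) by linarith
  then have "p * (d * \<eta> - L) \<le> 0" if "0 \<le> p" for p
    using that by (intro mult_nonneg_nonpos) auto
  ultimately show ?thesis
    using assms by (simp add: kkt_def)
qed

lemma kkt_hold:
  assumes "e \<in> {0..E}" "supergradient {0..E} V e d"
    and "d * \<eta> \<le> L" "0 < L \<Longrightarrow> L - c \<le> d / \<eta>"
  shows "kkt L e (0, 0, e) d"
proof -
  have "p * (d * \<eta> - L) \<le> 0" if "0 \<le> p" for p
    using that assms by (intro mult_nonneg_nonpos) auto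
  moreover have "p * (L - c - d / \<eta>) \<le> 0" if "0 \<le> p" "p > 0 \<longrightarrow> L > 0" for p
    using that assms(4) by (cases "p = 0") (auto intro!: mult_nonneg_nonpos)
  ultimately show ?thesis
    using assms P by (simp add: kkt_def feasible_def)
qed

section \<open>Derivative of the optimal value for each kind of policy\<close>

text \<open>The shift moves part of \<open>[0, E]\<close> outside the domain on which
  \<open>V\<close> is controlled, so the end state has to be interior, where \<open>V\<close> has a
  two-sided derivative.\<close>

lemma V_shift_deriv:
  assumes "0 < e + k" "e + k < E"
  shows "((\<lambda>y. V (y + k)) has_real_derivative D (e + k)) (at e within {0..E})"
proof -
  have "(V has_real_derivative D (e + k)) (at (e + k))"
    using V_deriv[of "e + k"] assms by (simp add: at_within_Icc_at)
  then have "((\<lambda>y. V (y + k)) has_real_derivative D (e + k)) (at e)"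
    by (simp add: DERIV_shift)
  then show ?thesis
    by (rule has_field_derivative_at_within)
qed

lemma q_charge_full:
  assumes e: "e \<in> {0..E}" "e + P * \<eta> < E" and L: "ereal (L / \<eta>) \<le> v (e + P * \<eta>)"
  shows "ereal (q L e) = v (e + P * \<eta>)"
proof -
  let ?z = "e + P * \<eta>"
  have z: "0 < ?z" "?z \<in> {0..E}"
    using e P \<eta> by (auto intro: add_nonneg_pos)
  have "L \<le> D ?z * \<eta>"
    using L \<eta> z by (simp add: v_eq_D field_simps)
  then have kkt: "kkt L e (P, 0, ?z) (D ?z)"
    using z e P by (intro kkt_charge supergradient_V) (auto simp: feasible_def)
  have "q L e = D ?z"
  proof (rule q_eqI[OF kkt e(1), of "\<lambda>y. V (y + P * \<eta>) - L * P"])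
    show "((\<lambda>y. V (y + P * \<eta>) - L * P) has_real_derivative D ?z) (at e within {0..E})"
      using DERIV_diff[OF V_shift_deriv[OF z(1) e(2)] DERIV_const] by simp
    \<comment> \<open>The strict bound on \<open>e\<close> leaves room for a full charge from all
      nearby states.\<close>
    have "eventually (\<lambda>y. y \<in> {..<E - P * \<eta>}) (nhds e)"
      using e by (intro eventually_nhds_in_open) auto
    then show "\<forall>\<^sub>F y in nhds e. y \<in> {0..E} \<longrightarrow>
        (\<exists>r\<in>feasible P E \<eta> L y. V (y + P * \<eta>) - L * P = profit c V L r)"
    proof eventually_elim
      case (elim y)
      show ?case
      proof
        assume "y \<in> {0..E}"
        with elim P \<eta> have "(P, 0, y + P * \<eta>) \<in> feasible P E \<eta> L y"
          by (auto simp: feasible_def)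
        then show "\<exists>r\<in>feasible P E \<eta> L y. V (y + P * \<eta>) - L * P = profit c V L r"
          by (rule bexI[rotated]) (simp add: profit_def)
      qed
    qed
  qed (auto simp: profit_def)
  with z show ?thesis
    by (simp add: v_eq_D)
qed

lemma q_discharge_full:
  assumes e: "e \<in> {0..E}" "0 < e - P / \<eta>" and L: "0 < L" "v (e - P / \<eta>) \<le> ereal ((L - c) * \<eta>)"
  shows "ereal (q L e) = v (e - P / \<eta>)"
proof -
  let ?z = "e - P / \<eta>"
  have "0 < P / \<eta>"
    using P \<eta> by simp
  with e have z: "?z < E" "?z \<in> {0..E}"
    unfolding atLeastAtMost_iff by linarith+
  have "D ?z / \<eta> \<le> L - c"
    using L \<eta> z by (simp add: v_eq_D field_simps)
  then have kkt: "kkt L e (0, P, ?z) (D ?z)"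
    using z e P L by (intro kkt_discharge supergradient_V) (auto simp: feasible_def)
  have "q L e = D ?z"
  proof (rule q_eqI[OF kkt e(1), of "\<lambda>y. V (y - P / \<eta>) + (L - c) * P"])
    show "((\<lambda>y. V (y - P / \<eta>) + (L - c) * P) has_real_derivative D ?z) (at e within {0..E})"
      using DERIV_add[OF V_shift_deriv[of e "- (P / \<eta>)"] DERIV_const] z(1) e by simp
    have "eventually (\<lambda>y. y \<in> {P / \<eta><..}) (nhds e)"
      using e by (intro eventually_nhds_in_open) auto
    then show "\<forall>\<^sub>F y in nhds e. y \<in> {0..E} \<longrightarrow>
        (\<exists>r\<in>feasible P E \<eta> L y. V (y - P / \<eta>) + (L - c) * P = profit c V L r)"
    proof eventually_elim
      case (elim y)
      show ?case
      proof
        assume "y \<in> {0..E}"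
        with elim P L \<open>0 < P / \<eta>\<close> have "(0, P, y - P / \<eta>) \<in> feasible P E \<eta> L y"
          by (auto simp: feasible_def)
        then show "\<exists>r\<in>feasible P E \<eta> L y. V (y - P / \<eta>) + (L - c) * P = profit c V L r"
          by (rule bexI[rotated]) (simp add: profit_def algebra_simps)
      qed
    qed
  qed (auto simp: profit_def algebra_simps)
  with z show ?thesis
    by (simp add: v_eq_D)
qed

text \<open>The target \<open>z\<close> stays fixed while the purchase
  \<open>(z - y) / \<eta>\<close> varies with the starting state \<open>y\<close>, so the profit is
  affine in \<open>y\<close> with slope \<open>L / \<eta>\<close>.\<close>

lemma q_charge_partial:
  assumes e: "e \<in> {0..E}" and L: "v (e + P * \<eta>) < ereal (L / \<eta>)" "ereal (L / \<eta>) < v e"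
  shows "q L e = L / \<eta>"
proof -
  have pos: "0 < P * \<eta>"
    using P \<eta> by simp
  obtain z where z: "z \<in> {0..E}" "e \<le> z" "z \<le> e + P * \<eta>" "supergradient {0..E} V z (L / \<eta>)"
    using supergradient_between[of "e + P * \<eta>" "L / \<eta>" e] L e pos by (auto simp: less_imp_le)
  \<comment> \<open>Equality would give \<open>L / \<eta> \<le> v (e + P * \<eta>)\<close>. Hence
    the power limit is slack and lower starting states can still reach \<open>z\<close>.\<close>
  have lt: "z < e + P * \<eta>"
    using supergradient_le_v[OF z(4)] z(1,3) L(1) e pos by (cases "z = e + P * \<eta>") auto
  have gt: "e < z \<or> z = E"
  proof (rule ccontr)
    assume "\<not> (e < z \<or> z = E)"
    with z(1,2) have "z = e" "0 \<le> z" "z < E"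
      by auto
    with v_le_supergradient[OF z(4)] L(2) show False
      by (simp add: not_le[symmetric])
  qed
  \<comment> \<open>If \<open>z = e\<close>, then both equal \<open>E\<close> and no admissible
    state lies above \<open>z\<close>; any bound beyond \<open>E\<close> then keeps the charge
    nonnegative.\<close>
  let ?b = "if e < z then z else E + 1"
  have kkt: "kkt L e ((z - e) / \<eta>, 0, z) (L / \<eta>)"
    using z \<eta> P by (intro kkt_charge) (auto simp: feasible_def field_simps)
  show ?thesis
  proof (rule q_eqI[OF kkt e(1), of "\<lambda>y. V z - L * ((z - y) / \<eta>)"])
    show "((\<lambda>y. V z - L * ((z - y) / \<eta>)) has_real_derivative L / \<eta>) (at e within {0..E})"
      using \<eta> by (auto intro!: derivative_eq_intros)
    have "eventually (\<lambda>y. y \<in> {z - P * \<eta><..<?b}) (nhds e)"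
      using lt e by (intro eventually_nhds_in_open) auto
    then show "\<forall>\<^sub>F y in nhds e. y \<in> {0..E} \<longrightarrow>
        (\<exists>r\<in>feasible P E \<eta> L y. V z - L * ((z - y) / \<eta>) = profit c V L r)"
    proof eventually_elim
      case (elim y)
      show ?case
      proof
        assume "y \<in> {0..E}"
        with elim gt z(1) P \<eta> have "((z - y) / \<eta>, 0, z) \<in> feasible P E \<eta> L y"
          by (auto simp: feasible_def field_simps split: if_splits)
        then show "\<exists>r\<in>feasible P E \<eta> L y. V z - L * ((z - y) / \<eta>) = profit c V L r"
          by (rule bexI[rotated]) (simp add: profit_def)
      qed
    qed
  qed (auto simp: profit_def)
qed

text \<open>Mirror image: the sale \<open>(y - z) * \<eta>\<close> varies with \<open>y\<close> and
  earns \<open>L - c\<close> per unit. The exceptional case is now \<open>z = e = 0\<close>, with no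
  admissible state below \<open>z\<close>.\<close>

lemma q_discharge_partial:
  assumes e: "e \<in> {0..E}"
    and L: "0 < L" "v e < ereal ((L - c) * \<eta>)" "ereal ((L - c) * \<eta>) < v (e - P / \<eta>)"
  shows "q L e = (L - c) * \<eta>"
proof -
  have pos: "0 < P / \<eta>"
    using P \<eta> by simp
  obtain z where z: "z \<in> {0..E}" "e - P / \<eta> \<le> z" "z \<le> e" "supergradient {0..E} V z ((L - c) * \<eta>)"
    using supergradient_between[of e "(L - c) * \<eta>" "e - P / \<eta>"] L e pos
    by (auto simp: less_imp_le)
  have gt: "e - P / \<eta> < z"
    using v_le_supergradient[OF z(4)] z(1,2) L(3) e pos by (cases "z = e - P / \<eta>") auto
  have lt: "z < e \<or> z = 0"
  proof (rule ccontr)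
    assume "\<not> (z < e \<or> z = 0)"
    with z(1,3) have "z = e" "0 < z" "z \<le> E"
      by auto
    with supergradient_le_v[OF z(4)] L(2) show False
      by (simp add: not_le[symmetric])
  qed
  let ?a = "if z < e then z else - 1"
  have kkt: "kkt L e (0, (e - z) * \<eta>, z) ((L - c) * \<eta>)"
    using z \<eta> P L by (intro kkt_discharge) (auto simp: feasible_def field_simps)
  show ?thesis
  proof (rule q_eqI[OF kkt e(1), of "\<lambda>y. V z + (L - c) * ((y - z) * \<eta>)"])
    show "((\<lambda>y. V z + (L - c) * ((y - z) * \<eta>)) has_real_derivative (L - c) * \<eta>) (at e within {0..E})"
      by (auto intro!: derivative_eq_intros)
    have "eventually (\<lambda>y. y \<in> {?a<..<z + P / \<eta>}) (nhds e)"
      using gt e by (intro eventually_nhds_in_open) auto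
    then show "\<forall>\<^sub>F y in nhds e. y \<in> {0..E} \<longrightarrow>
        (\<exists>r\<in>feasible P E \<eta> L y. V z + (L - c) * ((y - z) * \<eta>) = profit c V L r)"
    proof eventually_elim
      case (elim y)
      show ?case
      proof
        assume "y \<in> {0..E}"
        with elim lt z(1) P \<eta> L(1) have "(0, (y - z) * \<eta>, z) \<in> feasible P E \<eta> L y"
          by (auto simp: feasible_def field_simps split: if_splits)
        then show "\<exists>r\<in>feasible P E \<eta> L y. V z + (L - c) * ((y - z) * \<eta>) = profit c V L r"
          by (rule bexI[rotated]) (simp add: profit_def algebra_simps)
      qed
    qed
  qed (auto simp: profit_def algebra_simps)
qed

text \<open>Holding is feasible from every state, so \<open>V\<close> itself serves as the lower
  bound, also at the end points.\<close>

lemma q_hold: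
  assumes e: "e \<in> {0..E}"
    and L: "v e \<le> ereal (L / \<eta>)" "0 < L \<Longrightarrow> ereal ((L - c) * \<eta>) \<le> v e"
  shows "ereal (q L e) = v e"
proof -
  have "D e * \<eta> \<le> L" "0 < L \<Longrightarrow> L - c \<le> D e / \<eta>"
    using L \<eta> e by (auto simp: v_eq_D field_simps)
  then have kkt: "kkt L e (0, 0, e) (D e)"
    by (intro kkt_hold supergradient_V e)
  have "q L e = D e"
  proof (rule q_eqI[OF kkt e, of V])
    show "\<forall>\<^sub>F y in nhds e. y \<in> {0..E} \<longrightarrow> (\<exists>r\<in>feasible P E \<eta> L y. V y = profit c V L r)"
    proof (intro always_eventually allI impI)
      fix y assume "y \<in> {0..E}"
      with P have "(0, 0, y) \<in> feasible P E \<eta> L y"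
        by (simp add: feasible_def)
      then show "\<exists>r\<in>feasible P E \<eta> L y. V y = profit c V L r"
        by (rule bexI[rotated]) (simp add: profit_def)
    qed
  qed (use V_deriv[OF e] in \<open>auto simp: profit_def\<close>)
  with e show ?thesis
    by (simp add: v_eq_D)
qed

section \<open>Exceptional prices\<close>

text \<open>The price inequalities are strict because at equality the two competing multipliers
  coincide.\<close>

definition kinks :: "real \<Rightarrow> real set" where
  "kinks e = {L. e + P * \<eta> = E \<and> ereal (L / \<eta>) < v (e + P * \<eta>) \<or>
     e - P / \<eta> = 0 \<and> 0 < L \<and> v (e - P / \<eta>) < ereal ((L - c) * \<eta>)}"

text \<open>At a tie the full charge or discharge is only just optimal. Prices have a density, so ties form
  a null event.\<close>

definition ties :: "real \<Rightarrow> real set" where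
  "ties e = {L. ereal (L / \<eta>) = v (e + P * \<eta>) \<or> ereal ((L - c) * \<eta>) = v (e - P / \<eta>)}"

lemma finite_ties: "finite (ties e)"
proof (rule finite_subset)
  \<comment> \<open>An infinite \<open>v\<close> admits no tie; the default 0 of
    \<open>real_of_ereal\<close> then merely adds a harmless point.\<close>
  show "ties e \<subseteq> {\<eta> * real_of_ereal (v (e + P * \<eta>)), c + real_of_ereal (v (e - P / \<eta>)) / \<eta>}"
  proof
    fix L assume "L \<in> ties e"
    then consider "ereal (L / \<eta>) = v (e + P * \<eta>)" | "ereal ((L - c) * \<eta>) = v (e - P / \<eta>)"
      by (auto simp: ties_def)
    then show "L \<in> {\<eta> * real_of_ereal (v (e + P * \<eta>)), c + real_of_ereal (v (e - P / \<eta>)) / \<eta>}"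
      using \<eta> by cases (auto dest!: sym[of "ereal _"])
  qed
qed simp

lemma borel_kinks: "kinks e \<in> sets borel"
proof -
  have "{L. ereal (L / \<eta>) < a} \<in> sets borel" "{L. a < ereal ((L - c) * \<eta>)} \<in> sets borel" for a
    by measurable
  then show ?thesis
    unfolding kinks_def by measurable
qed

text \<open>The boundary slope of \<open>V\<close> and the slope given by the price are distinct
  multipliers of the same policy. Excluding the two corners makes \<open>e\<close> interior; at an
  end point of \<open>[0, E]\<close> two supergradients would not rule out a one-sided
  derivative.\<close>

lemma kink_not_differentiable:
  assumes L: "L \<in> kinks e" and e: "e \<in> {0..E}"
    and "\<not> (e = E \<and> E = P / \<eta>)" "\<not> (e = 0 \<and> E = P * \<eta>)"
  shows "\<not> W L differentiable (at e within {0..E}) \<and> q L e = (SOME D. False)"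
proof -
  consider (charge) "e + P * \<eta> = E" "ereal (L / \<eta>) < v E"
    | (discharge) "e = P / \<eta>" "0 < L" "v 0 < ereal ((L - c) * \<eta>)"
    using L by (auto simp: kinks_def)
  then show ?thesis
  proof cases
    case charge
    have "0 < P * \<eta>"
      using P \<eta> by simp
    with charge e assms(4) have "0 < e" "e < E"
      by (auto simp: less_le)
    have d: "L / \<eta> < D E"
      using charge E by (simp add: v_eq_D)
    then have L: "L \<le> D E * \<eta>"
      using \<eta> by (simp add: field_simps)
    have f: "(P, 0, E) \<in> feasible P E \<eta> L e"
      using charge P E by (auto simp: feasible_def)
    have "kkt L e (P, 0, E) (D E)" "kkt L e (P, 0, E) (L / \<eta>)"
      using f L d \<eta> by (auto intro!: kkt_charge supergradient_V_E)
    with d show ?thesis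
      using kkt_not_differentiable \<open>0 < e\<close> \<open>e < E\<close> by (metis less_irrefl)
  next
    case discharge
    have "0 < P / \<eta>"
      using P \<eta> by simp
    with discharge e assms(3) have "0 < e" "e < E"
      by (auto simp: less_le)
    have d: "D 0 < (L - c) * \<eta>"
      using discharge E by (simp add: v_eq_D)
    then have L: "D 0 / \<eta> \<le> L - c"
      using \<eta> by (simp add: field_simps)
    have f: "(0, P, 0) \<in> feasible P E \<eta> L e"
      using discharge P E by (auto simp: feasible_def)
    have "kkt L e (0, P, 0) (D 0)" "kkt L e (0, P, 0) ((L - c) * \<eta>)"
      using f L d \<eta> discharge by (auto intro!: kkt_discharge supergradient_V_0)
    with d show ?thesis
      using kkt_not_differentiable \<open>0 < e\<close> \<open>e < E\<close> by (metis less_irrefl)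
  qed
qed

section \<open>The marginal value as a function of the price\<close>

lemma q_formula:
  assumes e: "e \<in> {0..E}" and L: "L \<notin> kinks e" "L \<notin> ties e"
  shows "ereal (q L e) =
    (if ereal (L / \<eta>) < v e then max (ereal (L / \<eta>)) (v (e + P * \<eta>))
     else if 0 < L \<and> v e < ereal ((L - c) * \<eta>) then min (ereal ((L - c) * \<eta>)) (v (e - P / \<eta>))
     else v e)"
proof -
  \<comment> \<open>Without ties, the comparisons with \<open>v\<close> at the fully charged and
    fully discharged states are strict, which leaves five cases.\<close>
  consider (charge_full) "ereal (L / \<eta>) < v (e + P * \<eta>)" "ereal (L / \<eta>) < v e"
    | (charge_partial) "v (e + P * \<eta>) < ereal (L / \<eta>)" "ereal (L / \<eta>) < v e"
    | (hold) "v e \<le> ereal (L / \<eta>)" "\<not> (0 < L \<and> v e < ereal ((L - c) * \<eta>))"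
    | (discharge_partial) "v e \<le> ereal (L / \<eta>)" "0 < L" "v e < ereal ((L - c) * \<eta>)"
        "ereal ((L - c) * \<eta>) < v (e - P / \<eta>)"
    | (discharge_full) "v e \<le> ereal (L / \<eta>)" "0 < L" "v e < ereal ((L - c) * \<eta>)"
        "v (e - P / \<eta>) < ereal ((L - c) * \<eta>)"
    using L(2) unfolding ties_def mem_Collect_eq by (meson not_le neq_iff)
  then show ?thesis
  proof cases
    case charge_full
    \<comment> \<open>Beyond \<open>E\<close> the value of \<open>v\<close> is
      \<open>-\<infinity>\<close>, and landing exactly on \<open>E\<close> would be a kink.\<close>
    then have "e + P * \<eta> < E"
      using L(1) by (cases "e + P * \<eta>" E rule: linorder_cases) (auto simp: kinks_def marginal_value_def)
    with charge_full show ?thesis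
      using q_charge_full[OF e] by (simp add: less_imp_le)
  next
    case charge_partial
    then show ?thesis
      using q_charge_partial[OF e] by simp
  next
    case hold
    then show ?thesis
      using q_hold[OF e, of L] by (auto simp: not_less)
  next
    case discharge_partial
    then show ?thesis
      using q_discharge_partial[OF e] leD[OF discharge_partial(1)] by simp
  next
    case discharge_full
    then have "0 < e - P / \<eta>"
      using L(1) e P \<eta> by (cases "e - P / \<eta>" "0::real" rule: linorder_cases)
        (auto simp: kinks_def marginal_value_def split: if_splits)
    with discharge_full show ?thesis
      using q_discharge_full[OF e] leD[OF discharge_full(1)] by (simp add: less_imp_le)
  qed
qed

text \<open>Charging yields values between \<open>v (e + P * \<eta>)\<close> and \<open>v e\<close>,
  discharging values between \<open>v e\<close> and \<open>v (e - P / \<eta>)\<close>; the position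
  of \<open>x\<close> decides which branch matters.\<close>

lemma q_le_iff:
  assumes e: "e \<in> {0..E}" and L: "L \<notin> kinks e" "L \<notin> ties e"
  shows "ereal x < v (e + P * \<eta>) \<Longrightarrow> \<not> q L e \<le> x"
    and "v (e + P * \<eta>) \<le> ereal x \<Longrightarrow> ereal x < v e \<Longrightarrow> q L e \<le> x \<longleftrightarrow> L \<le> x * \<eta>"
    and "v e \<le> ereal x \<Longrightarrow> ereal x < v (e - P / \<eta>) \<Longrightarrow> q L e \<le> x \<longleftrightarrow> L \<le> max (x / \<eta> + c) 0"
    and "v (e - P / \<eta>) \<le> ereal x \<Longrightarrow> q L e \<le> x"
proof -
  have ord: "v (e + P * \<eta>) \<le> v e" "v e \<le> v (e - P / \<eta>)"
    using P \<eta> by (auto intro: v_antimono)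
  obtain b where b: "v e = ereal b"
    using e by (simp add: v_eq_D)
  note q = q_formula[OF assms, unfolded b]
  have le: "q L e \<le> x \<longleftrightarrow> ereal (q L e) \<le> ereal x"
    by simp
  have charge: "L / \<eta> \<le> x \<longleftrightarrow> L \<le> x * \<eta>"
    using \<eta> by (simp add: field_simps)
  have discharge: "(L - c) * \<eta> \<le> x \<longleftrightarrow> L \<le> x / \<eta> + c"
    using \<eta> by (simp add: field_simps)
  \<comment> \<open>The round-trip loss with \<open>d = L / \<eta>\<close>: at a positive price the
    discharge slope lies below the charge slope.\<close>
  have loss: "(L - c) * \<eta> \<le> L / \<eta>" if "0 < L"
    using round_trip_loss[of L "L / \<eta>"] that \<eta> by (simp add: field_simps)
  show "\<not> q L e \<le> x" if "ereal x < v (e + P * \<eta>)"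
  proof -
    have "v (e + P * \<eta>) \<le> ereal (q L e)"
      unfolding q using ord b by (auto simp: min_def intro: order_trans)
    with that show ?thesis
      using less_le_trans by fastforce
  qed
  show "q L e \<le> x" if "v (e - P / \<eta>) \<le> ereal x"
  proof -
    have "ereal (q L e) \<le> v (e - P / \<eta>)"
      unfolding q using ord b
      by (auto simp: max_def min_def intro: order_trans[of _ "ereal b"])
    with that show ?thesis
      using order_trans by fastforce
  qed
  show "q L e \<le> x \<longleftrightarrow> L \<le> x * \<eta>" if "v (e + P * \<eta>) \<le> ereal x" "ereal x < v e"
  proof -
    have "x < b"
      using that b by simp
    then have "L \<le> x * \<eta> \<Longrightarrow> L / \<eta> < b" "0 < L \<Longrightarrow> b < (L - c) * \<eta> \<Longrightarrow> \<not> L \<le> x * \<eta>"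
      using charge loss by linarith+
    moreover have "\<not> v (e - P / \<eta>) \<le> ereal x"
      using that(2) ord(2) by (simp add: not_le less_le_trans)
    ultimately show ?thesis
      unfolding le q using that ord b charge \<open>x < b\<close>
      by (auto simp: min_le_iff_disj)
  qed
  \<comment> \<open>For \<open>L \<le> 0\<close> discharging is forbidden and \<open>q L e\<close>
    is at most \<open>v e\<close>; hence the threshold is cut off at 0.\<close>
  show "q L e \<le> x \<longleftrightarrow> L \<le> max (x / \<eta> + c) 0" if "v e \<le> ereal x" "ereal x < v (e - P / \<eta>)"
  proof -
    have "b \<le> x"
      using that b by simp
    moreover have "v (e + P * \<eta>) \<le> ereal x"
      using ord(1) that(1) by (rule order_trans)
    moreover have "L \<le> x / \<eta> + c" if "0 < L" "L / \<eta> < b"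
      using that \<open>b \<le> x\<close> loss discharge by linarith
    ultimately show ?thesis
      unfolding le q using that discharge by (auto simp: min_le_iff_disj le_max_iff_disj)
  qed
qed

section \<open>From prices to probabilities\<close>

text \<open>Kinks have probability 0 by differentiability, ties by assumption. Almost sure equality
  of the events gives equal measures only once both are known to be measurable, so the exceptional
  prices are first handled explicitly.\<close>

lemma measure_q_le:
  assumes M: "prob_space M" and X: "X \<in> borel_measurable M"
    and ties: "AE \<omega> in M. X \<omega> \<notin> ties e"
    and e: "e \<in> {0..E}" "\<not> (e = E \<and> E = P / \<eta>)" "\<not> (e = 0 \<and> E = P * \<eta>)"
    and diff: "AE \<omega> in M. W (X \<omega>) differentiable (at e within {0..E})"
    and S: "S \<in> sets borel" "\<And>L. L \<notin> kinks e \<Longrightarrow> L \<notin> ties e \<Longrightarrow> q L e \<le> x \<longleftrightarrow> L \<in> S"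
  shows "measure M {\<omega> \<in> space M. q (X \<omega>) e \<le> x} = measure M {\<omega> \<in> space M. X \<omega> \<in> S}"
proof -
  interpret prob_space M
    by fact
  let ?B = "{L. q L e \<le> x}"
  have kink: "W L differentiable (at e within {0..E}) \<Longrightarrow> L \<notin> kinks e"
    "L \<in> kinks e \<Longrightarrow> q L e = (SOME D. False)" for L
    using kink_not_differentiable[OF _ e] by blast+
  \<comment> \<open>On \<open>kinks e\<close> the constant value of \<open>q\<close> makes the
    condition hold everywhere or nowhere; on the finite set \<open>ties e\<close> any subset is
    Borel.\<close>
  have "?B = (S - kinks e - ties e) \<union> (if (SOME D. False) \<le> x then kinks e else {})
      \<union> (ties e \<inter> ?B - kinks e)"
    (is "_ = ?R")
  proof (rule set_eqI)
    fix L show "L \<in> ?B \<longleftrightarrow> L \<in> ?R"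
      using S(2)[of L] kink(2)[of L] by (cases "L \<in> kinks e"; cases "L \<in> ties e") simp_all
  qed
  moreover have "ties e \<inter> ?B \<in> sets borel" "ties e \<in> sets borel"
    using finite_ties by (auto intro!: borel_closed finite_imp_closed)
  then have "(S - kinks e - ties e) \<union> (if (SOME D. False) \<le> x then kinks e else {})
      \<union> (ties e \<inter> ?B - kinks e) \<in> sets borel"
    using borel_kinks[of e] S(1) by auto
  ultimately have "?B \<in> sets borel"
    by simp
  then have meas: "{\<omega> \<in> space M. q (X \<omega>) e \<le> x} \<in> sets M" "{\<omega> \<in> space M. X \<omega> \<in> S} \<in> sets M"
    using measurable_sets[OF X, of ?B] measurable_sets[OF X S(1)]
    by (simp_all add: vimage_def Int_def conj_commute)
  have "AE \<omega> in M. \<omega> \<in> {\<omega> \<in> space M. q (X \<omega>) e \<le> x} \<longleftrightarrow> \<omega> \<in> {\<omega> \<in> space M. X \<omega> \<in> S}"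
    using ties diff by eventually_elim (use S(2) kink(1) in auto)
  then show ?thesis
    using meas by (intro finite_measure_eq_AE)
qed

end

lemma distributed_lborel_AE_notin_finite:
  fixes X :: "'a \<Rightarrow> real"
  assumes "distributed M lborel X f" "finite A"
  shows "AE \<omega> in M. X \<omega> \<notin> A"
proof -
  have X: "X \<in> measurable M lborel"
    using assms(1) by (rule distributed_measurable)
  have "AE y in lborel. y \<notin> A"
    using assms(2) by (intro AE_not_in finite_imp_null_set_lborel)
  then have "AE y in density lborel f. y \<notin> A"
    using distributed_borel_measurable[OF assms(1)] by (subst AE_density) auto
  then have "AE y in distr M lborel X. y \<notin> A"
    unfolding distributed_distr_eq_density[OF assms(1)] .
  with X show ?thesis
    by (rule AE_distrD)
qed

theorem theorem4:
  fixes M :: "'a measure"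
    and T t :: nat
    and P E \<eta> c e x :: real
    and lam :: "nat \<Rightarrow> 'a \<Rightarrow> real"
    and f :: "nat \<Rightarrow> real \<Rightarrow> ennreal"
    and V :: "nat \<Rightarrow> real \<Rightarrow> real"
  defines "F \<equiv> \<lambda>s. cdf (distr M borel (lam s))"
    and "v \<equiv> \<lambda>s. marginal_value E (V s)"
    and "Q \<equiv> \<lambda>s \<omega>. opt_value P E \<eta> c (V s) (lam s \<omega>)"
    and "q \<equiv> \<lambda>s \<omega>. marginal_opt_value P E \<eta> c (V s) (lam s \<omega>)"
  assumes "prob_space M"
    and "P > 0" and "E > 0" and "0 < \<eta>" and "\<eta> \<le> 1" and "c > 0"
    and "prob_space.indep_vars M (\<lambda>_. borel) lam {1..T}"
    and "\<And>s. s \<in> {1..T} \<Longrightarrow> distributed M lborel (lam s) (f s)"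
    and "\<And>s y. s \<in> {1..T} \<Longrightarrow> y \<in> {0..E} \<Longrightarrow>
           has_bochner_integral M (\<lambda>\<omega>. Q s \<omega> y) (V (s - 1) y)"
    and "t \<in> {1..T}"
    and "concave_on {0..E} (V t)"
    and "V t differentiable_on {0..E}"
    and "e \<in> {0..E}"
    and "AE \<omega> in M. Q t \<omega> differentiable (at e within {0..E})"
    and "\<not> (e = E \<and> E = P / \<eta>)"
    and "\<not> (e = 0 \<and> E = P * \<eta>)"
  shows "(ereal x < v t (e + P * \<eta>) \<longrightarrow>
            measure M {\<omega> \<in> space M. q t \<omega> e \<le> x} = 0) \<and>
         (v t (e + P * \<eta>) \<le> ereal x \<and> ereal x < v t e \<longrightarrow>
            measure M {\<omega> \<in> space M. q t \<omega> e \<le> x} = F t (x * \<eta>)) \<and>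
         (v t e \<le> ereal x \<and> ereal x < v t (e - P / \<eta>) \<longrightarrow>
            measure M {\<omega> \<in> space M. q t \<omega> e \<le> x} = F t (max (x / \<eta> + c) 0)) \<and>
         (v t (e - P / \<eta>) \<le> ereal x \<longrightarrow>
            measure M {\<omega> \<in> space M. q t \<omega> e \<le> x} = 1)"
proof -
  interpret prob_space M
    by fact
  interpret storage P E \<eta> c "V t"
    by unfold_locales fact+
  have dist: "distributed M lborel (lam t) (f t)"
    using assms by blast
  then have lam: "lam t \<in> borel_measurable M"
    using distributed_measurable by fastforce
  have F: "F t y = measure M {\<omega> \<in> space M. lam t \<omega> \<in> {..y}}" for y
    unfolding F_def cdf_def using lam
    by (simp add: measure_distr vimage_def Int_def conj_commute)
  have ties: "AE \<omega> in M. lam t \<omega> \<notin> ties e"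
    using dist finite_ties by (rule distributed_lborel_AE_notin_finite)
  have e: "e \<in> {0..E}" "\<not> (e = E \<and> E = P / \<eta>)" "\<not> (e = 0 \<and> E = P * \<eta>)"
    by fact+
  have diff: "AE \<omega> in M. opt_value P E \<eta> c (V t) (lam t \<omega>) differentiable (at e within {0..E})"
    using assms unfolding Q_def by blast
  note q_meas = measure_q_le[OF \<open>prob_space M\<close> lam ties e diff, of _ x]
  note iff = q_le_iff[OF e(1), of _ x]
  let ?v = "marginal_value E (V t)"
  let ?pr = "measure M {\<omega> \<in> space M. marginal_opt_value P E \<eta> c (V t) (lam t \<omega>) e \<le> x}"
  \<comment> \<open>The four cases correspond to the price sets \<open>{}\<close>,
    \<open>{..x * \<eta>}\<close>, \<open>{..max (x / \<eta> + c) 0}\<close> and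
    \<open>UNIV\<close>.\<close>
  have "?pr = 0" if "ereal x < ?v (e + P * \<eta>)"
    using q_meas[of "{}"] iff(1) that by simp
  moreover have "?pr = F t (x * \<eta>)" if "?v (e + P * \<eta>) \<le> ereal x" "ereal x < ?v e"
    unfolding F using iff(2) that by (intro q_meas) auto
  moreover have "?pr = F t (max (x / \<eta> + c) 0)" if "?v e \<le> ereal x" "ereal x < ?v (e - P / \<eta>)"
    unfolding F using iff(3) that by (intro q_meas) auto
  moreover have "?pr = 1" if "?v (e - P / \<eta>) \<le> ereal x"
    using q_meas[of UNIV] iff(4) that by (simp add: prob_space)
  ultimately show ?thesis
    unfolding v_def q_def by blast
qed

end
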